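(* Let $K$ be a field of characteristic zero and let $L$ be a finite-dimensional nilpotent Lie algebra over $K$. Then $L$ has a faithful nilpotent representation, i.e. there exist a finite-dimensional $K$-vector space $V$ and an injective Lie algebra homomorphism $\rho : L \to \operatorname{End}(V)$ such that $\rho(x)$ is a nilpotent linear map for every $x \in L$.
   Context: All Lie algebras, modules and vector spaces are finite-dimensional. A representation $\rho : L \to \operatorname{End}(V)$ of a Lie algebra $L$ (where $\operatorname{End}(V)$ carries the commutator bracket) is called nilpotent if $\rho(x)$ is a nilpotent linear map for every $x \in L$. It is faithful if $\operatorname{Ker} \rho = 0$. *)

theory Defs
  imports Complex_Main "HOL-Library.FuncSet" "HOL-Library.Function_Algebras"
begin

locale lie_algebra = vector_space scale
  for scale :: "'k::field \<Rightarrow> 'l::ab_group_add \<Rightarrow> 'l" +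
  fixes bracket :: "'l \<Rightarrow> 'l \<Rightarrow> 'l"
  assumes bracket_linear_left: "Vector_Spaces.linear scale scale (\<lambda>x. bracket x y)"
    and bracket_linear_right: "Vector_Spaces.linear scale scale (bracket x)"
    and bracket_self: "bracket x x = 0"
    and jacobi: "bracket x (bracket y z) + bracket y (bracket z x) + bracket z (bracket x y) = 0"
begin

primrec lower_central_series :: "nat \<Rightarrow> 'l set" where
  "lower_central_series 0 = UNIV"
| "lower_central_series (Suc n) = span {bracket x y | x y. y \<in> lower_central_series n}"

end

locale nilpotent_lie_algebra = lie_algebra +
  assumes lower_central_series_terminates: "\<exists>n. lower_central_series n = {0}"

text \<open>
  Representation spaces are subspaces \<open>V\<close> of an ambient vector space. The elements of
  \<open>End(V)\<close> are taken in \<open>V \<rightarrow>\<^sub>E V\<close>, with the fixed value \<open>undefined\<close> outside \<open>V\<close>, so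
  that two endomorphisms are equal as HOL functions exactly if they agree on \<open>V\<close>.
\<close>

definition End :: "('k::field \<Rightarrow> 'v::ab_group_add \<Rightarrow> 'v) \<Rightarrow> 'v set \<Rightarrow> ('v \<Rightarrow> 'v) set" where
  "End scale V = {f \<in> V \<rightarrow>\<^sub>E V.
     (\<forall>u\<in>V. \<forall>v\<in>V. f (u + v) = f u + f v) \<and> (\<forall>c. \<forall>v\<in>V. f (scale c v) = scale c (f v))}"

definition commutator :: "'v::ab_group_add set \<Rightarrow> ('v \<Rightarrow> 'v) \<Rightarrow> ('v \<Rightarrow> 'v) \<Rightarrow> 'v \<Rightarrow> 'v" where
  "commutator V f g = (\<lambda>v\<in>V. f (g v) - g (f v))"

locale lie_representation =
  L: lie_algebra scale bracket + ambient: vector_space scaleV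
  for scale :: "'k::field \<Rightarrow> 'l::ab_group_add \<Rightarrow> 'l" and bracket
    and scaleV :: "'k \<Rightarrow> 'v::ab_group_add \<Rightarrow> 'v" +
  fixes V :: "'v set" and \<rho> :: "'l \<Rightarrow> 'v \<Rightarrow> 'v"
  assumes subspace: "ambient.subspace V"
    and finite_dimensional: "\<exists>B. finite B \<and> ambient.span B = V"
    and rep_End: "\<rho> x \<in> End scaleV V"
    and rep_add: "\<rho> (x + y) = (\<lambda>v\<in>V. \<rho> x v + \<rho> y v)"
    and rep_scale: "\<rho> (scale c x) = (\<lambda>v\<in>V. scaleV c (\<rho> x v))"
    and rep_bracket: "\<rho> (bracket x y) = commutator V (\<rho> x) (\<rho> y)"

locale nilpotent_representation = lie_representation +
  assumes rep_nilpotent: "\<exists>n. \<forall>v\<in>V. (\<rho> x ^^ n) v = 0"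

locale faithful_representation = lie_representation +
  assumes kernel_trivial: "{x. \<rho> x = (\<lambda>v\<in>V. 0)} = {0}"

lemma (in lie_representation) kernel_trivial_iff_inj:
  "{x. \<rho> x = (\<lambda>v\<in>V. 0)} = {0} \<longleftrightarrow> inj \<rho>"
proof -
  have zero: "\<rho> 0 = (\<lambda>v\<in>V. 0)"
    using rep_scale[of 0 0] by simp
  have ext: "\<rho> x \<in> extensional V" for x
    using rep_End[of x] by (auto simp: End_def PiE_def)
  have diff: "\<rho> (x - y) = (\<lambda>v\<in>V. 0)" if "\<rho> x = \<rho> y" for x y
  proof -
    have "\<rho> x v = \<rho> (x - y) v + \<rho> y v" if "v \<in> V" for v
      using rep_add[of "x - y" y] that by simp
    then have "\<rho> (x - y) v = (\<lambda>v\<in>V. 0) v" if "v \<in> V" for v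
      using that \<open>\<rho> x = \<rho> y\<close> by simp
    then show ?thesis
      by (intro extensionalityI[OF ext]) auto
  qed
  show ?thesis
  proof
    assume ker: "{x. \<rho> x = (\<lambda>v\<in>V. 0)} = {0}"
    show "inj \<rho>"
    proof (rule injI)
      fix x y assume "\<rho> x = \<rho> y"
      then have "x - y \<in> {0}" using diff ker by blast
      then show "x = y" by simp
    qed
  next
    assume "inj \<rho>"
    then show "{x. \<rho> x = (\<lambda>v\<in>V. 0)} = {0}"
      using zero by (auto simp: inj_def)
  qed
qed

text \<open>
  The space \<open>K\<^sup>\<nat>\<close> of sequences. It contains a copy of every finite-dimensional vector
  space over \<open>K\<close>, so its finite-dimensional subspaces can serve as the range of an
  existential quantifier over all finite-dimensional \<open>K\<close>-vector spaces.
\<close>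

definition seq_scale :: "'k::field \<Rightarrow> (nat \<Rightarrow> 'k) \<Rightarrow> nat \<Rightarrow> 'k" where
  "seq_scale c f = (\<lambda>i. c * f i)"

lemma vector_space_seq_scale: "vector_space seq_scale"
  by unfold_locales (auto simp: seq_scale_def fun_eq_iff algebra_simps)

end

theory Submission
  imports Defs
begin

text \<open>
  Let \<open>L\<close> be nilpotent with lower central series \<open>L = F\<^sub>0 \<supseteq> F\<^sub>1 \<supseteq> \<dots> \<supseteq> F\<^sub>n = 0\<close>. The
  classical candidate for the representation is \<open>U(L)\<close> modulo the span of the products of
  weight at least \<open>k = n + 1\<close>, where an element of \<open>F\<^sub>i\<close> has weight \<open>i + 1\<close>. Here \<open>L\<close> acts on
  the dual of this algebra, which can be written down without quotients: a functional is a
  function \<open>\<phi>\<close> on words in \<open>L\<close> that is linear in every letter, satisfies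
  \<open>\<phi>(u a b v) - \<phi>(u b a v) = \<phi>(u [a,b] v)\<close> and vanishes on words of weight at least \<open>k\<close>
  (\<open>enveloping_dual\<close>). The action of \<open>x\<close> sends \<open>\<phi>\<close> to \<open>w \<mapsto> - \<phi>(x w)\<close>. It is a representation by
  the second condition and nilpotent by the third; the space is finite-dimensional because a
  functional is determined by its values on the short words in a basis.

  It is faithful if every \<open>x \<noteq> 0\<close> is detected by a functional \<open>\<phi>\<close> with \<open>\<phi>(x) \<noteq> 0\<close>, which
  says that \<open>L\<close> embeds in the truncated enveloping algebra. In place of the
  Poincare-Birkhoff-Witt theorem, this is proved by induction along a chain of ideals \<open>M\<close> that
  refines the lower central series (\<open>separated_insert\<close>, \<open>separated_UNIV\<close>), imposing the
  conditions on words in \<open>M\<close> only. Let \<open>M' = M + K x\<close>. The new direction \<open>x\<close> is detected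
  by its coordinate, as a functional on words of length one, because \<open>[M', M'] \<subseteq> M\<close>. An element of
  \<open>M\<close> is detected by some \<open>\<phi>\<close> for \<open>M\<close>, and \<open>\<phi>\<close> extends to \<open>M'\<close>: the algebra \<open>M'\<close>
  acts on the functionals for \<open>M\<close>, elements of \<open>M\<close> by translation and \<open>x\<close> by the
  derivation that \<open>ad x\<close> induces on words, and the extension is the matrix coefficient
  \<open>y\<^sub>1 \<dots> y\<^sub>r \<mapsto> (y\<^sub>r \<cdots> y\<^sub>1 \<phi>)(1)\<close> (\<open>enveloping_dual_extension\<close>). Weights survive because a letter of
  \<open>F\<^sub>i\<close> lowers the weight at which a functional vanishes by \<open>i + 1\<close>
  (\<open>enveloping_dual_extended_action\<close>).
\<close>

section \<open>Lie brackets and the lower central series\<close>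

context lie_algebra
begin

lemma bracket_add_left: "bracket (x + y) z = bracket x z + bracket y z"
  and bracket_scale_left: "bracket (scale c x) z = scale c (bracket x z)"
  and bracket_add_right: "bracket z (x + y) = bracket z x + bracket z y"
  and bracket_scale_right: "bracket z (scale c x) = scale c (bracket z x)"
  using bracket_linear_left[of z] bracket_linear_right[of z]
  by (simp_all add: Vector_Spaces.linear_iff)

lemmas bracket_linear = bracket_add_left bracket_scale_left bracket_add_right bracket_scale_right

lemma bracket_zero_left: "bracket 0 z = 0"
  using bracket_scale_left[of 0 0 z] by simp

lemma bracket_skew: "bracket y x = - bracket x y"
proof -
  have "bracket x y + bracket y x = bracket (x + y) (x + y)"
    unfolding bracket_add_left bracket_add_right by (simp add: bracket_self)
  then show ?thesis
    by (simp add: bracket_self eq_neg_iff_add_eq_0 add.commute)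
qed

lemma bracket_minus_right: "bracket z (- x) = - bracket z x"
  using bracket_scale_right[of z "-1" x] by simp

text \<open>The Jacobi identity in the form that \<open>ad x\<close> is a derivation of the bracket.\<close>

lemma bracket_bracket_right:
  "bracket x (bracket y z) = bracket (bracket x y) z + bracket y (bracket x z)"
proof -
  have "bracket y (bracket z x) = - bracket y (bracket x z)"
    by (simp add: bracket_skew[of z x] bracket_minus_right)
  moreover have "bracket z (bracket x y) = - bracket (bracket x y) z"
    by (rule bracket_skew)
  ultimately show ?thesis
    using jacobi[of x y z] by (simp add: algebra_simps)
qed

lemma subspace_lower_central_series: "subspace (lower_central_series n)"
  by (cases n) (auto simp: subspace_span)

lemma bracket_lower_central_series_Suc:
  "y \<in> lower_central_series n \<Longrightarrow> bracket x y \<in> lower_central_series (Suc n)"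
  by (auto intro: span_base)

lemma lower_central_series_Suc_subset: "lower_central_series (Suc n) \<subseteq> lower_central_series n"
proof (induction n)
  case (Suc n)
  show ?case
    unfolding lower_central_series.simps(2)[of "Suc n"]
  proof (rule span_minimal[OF _ subspace_lower_central_series])
    show "{bracket x y |x y. y \<in> lower_central_series (Suc n)} \<subseteq> lower_central_series (Suc n)"
      using Suc bracket_lower_central_series_Suc by blast
  qed
qed simp

lemma lower_central_series_antimono:
  "m \<le> n \<Longrightarrow> lower_central_series n \<subseteq> lower_central_series m"
  by (rule lift_Suc_antimono_le[of lower_central_series]) (rule lower_central_series_Suc_subset)

text \<open>
  Assigning weight \<open>i + 1\<close> to the \<open>i\<close>-th term makes the bracket additive on weights. Jacobi moves an
  outer factor of \<open>x = [u, z]\<close> out of the bracket, which allows induction on the weight of \<open>x\<close>.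
\<close>

lemma bracket_lower_central_series:
  assumes "x \<in> lower_central_series a" "y \<in> lower_central_series b"
  shows "bracket x y \<in> lower_central_series (Suc (a + b))"
  using assms
proof (induction a arbitrary: x y b)
  case 0
  then show ?case by (simp only: add_0 bracket_lower_central_series_Suc)
next
  case (Suc a)
  let ?T = "lower_central_series (Suc (Suc a + b))"
  let ?S = "{z. bracket z y \<in> ?T}"
  have T: "subspace ?T" by (rule subspace_lower_central_series)
  have "subspace ?S"
    using T by (auto simp: subspace_def bracket_linear bracket_zero_left)
  moreover have "{bracket u z |u z. z \<in> lower_central_series a} \<subseteq> ?S"
  proof clarify
    fix u z assume z: "z \<in> lower_central_series a"
    have "bracket u (bracket z y) \<in> ?T"
      using bracket_lower_central_series_Suc[OF Suc.IH[OF z Suc.prems(2)]] by simp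
    moreover have "bracket z (bracket u y) \<in> ?T"
      using Suc.IH[OF z bracket_lower_central_series_Suc[OF Suc.prems(2)]] by simp
    ultimately have "bracket u (bracket z y) - bracket z (bracket u y) \<in> ?T"
      by (rule subspace_diff[OF T])
    then show "bracket (bracket u z) y \<in> ?T"
      by (simp only: bracket_bracket_right[of u z y] add_diff_cancel_right')
  qed
  ultimately have "lower_central_series (Suc a) \<subseteq> ?S"
    unfolding lower_central_series.simps by (rule span_minimal[rotated])
  then show ?case using Suc.prems(1) by blast
qed

section \<open>The dual of the truncated enveloping algebra\<close>

text \<open>
  A word is \<open>k\<close>-heavy if its letters can be assigned weights with sum at least \<open>k\<close>. The truncated
  subtraction absorbs any excess over \<open>k\<close>.
\<close>

primrec heavy :: "nat \<Rightarrow> 'l list \<Rightarrow> bool" where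
  "heavy k [] \<longleftrightarrow> k = 0"
| "heavy k (y # w) \<longleftrightarrow> (\<exists>n. y \<in> lower_central_series n \<and> heavy (k - Suc n) w)"

lemma heavy_mono: "heavy k w \<Longrightarrow> j \<le> k \<Longrightarrow> heavy j w"
proof (induction w arbitrary: j k)
  case (Cons y w)
  then show ?case by simp (meson diff_le_mono)
qed simp

lemma heavy_length: "k \<le> length w \<Longrightarrow> heavy k w"
proof (induction w arbitrary: k)
  case (Cons y w)
  then have "y \<in> lower_central_series 0 \<and> heavy (k - Suc 0) w" by auto
  then show ?case unfolding heavy.simps by blast
qed simp

definition slotwise_linear :: "('l list \<Rightarrow> 'k) \<Rightarrow> bool" where
  "slotwise_linear \<phi> \<longleftrightarrow>
    (\<forall>u v y z. \<phi> (u @ (y + z) # v) = \<phi> (u @ y # v) + \<phi> (u @ z # v)) \<and>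
    (\<forall>u v r y. \<phi> (u @ scale r y # v) = r * \<phi> (u @ y # v))"

text \<open>
  For a subalgebra \<open>M\<close>, the restrictions of these functions to words in \<open>M\<close> form the dual of
  \<open>U(M)\<close> modulo the heavy words. Linearity is nevertheless imposed on words in the whole algebra, so
  that it is an unconditional rewrite rule; the values on other words are otherwise arbitrary.
\<close>

definition enveloping_dual :: "'l set \<Rightarrow> nat \<Rightarrow> ('l list \<Rightarrow> 'k) set" where
  "enveloping_dual M k = {\<phi>. slotwise_linear \<phi> \<and>
    (\<forall>u\<in>lists M. \<forall>a\<in>M. \<forall>b\<in>M. \<forall>v\<in>lists M.
      \<phi> (u @ a # b # v) - \<phi> (u @ b # a # v) = \<phi> (u @ bracket a b # v)) \<and>
    (\<forall>w\<in>lists M. heavy k w \<longrightarrow> \<phi> w = 0)}"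

lemma slotwise_linear_add: "slotwise_linear \<phi> \<Longrightarrow> \<phi> (u @ (y + z) # v) = \<phi> (u @ y # v) + \<phi> (u @ z # v)"
  and slotwise_linear_scale: "slotwise_linear \<phi> \<Longrightarrow> \<phi> (u @ scale r y # v) = r * \<phi> (u @ y # v)"
  by (simp_all add: slotwise_linear_def)

lemma slotwise_linear_head:
  assumes "slotwise_linear \<phi>"
  shows "\<phi> ((y + z) # v) = \<phi> (y # v) + \<phi> (z # v)" "\<phi> (scale r y # v) = r * \<phi> (y # v)"
  using slotwise_linear_add[OF assms, of "[]"] slotwise_linear_scale[OF assms, of "[]"] by simp_all

lemma slotwise_linear_translate: "slotwise_linear \<phi> \<Longrightarrow> slotwise_linear (\<lambda>v. \<phi> (m # v))"
  unfolding slotwise_linear_def by (metis append_Cons)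

lemma slotwise_linear_combination:
  "slotwise_linear \<phi> \<Longrightarrow> slotwise_linear \<psi> \<Longrightarrow> slotwise_linear (\<lambda>w. r * \<phi> w + s * \<psi> w)"
  by (simp add: slotwise_linear_def algebra_simps)

lemma enveloping_dualI:
  assumes "slotwise_linear \<phi>"
    and "\<And>u a b v. u \<in> lists M \<Longrightarrow> a \<in> M \<Longrightarrow> b \<in> M \<Longrightarrow> v \<in> lists M \<Longrightarrow>
      \<phi> (u @ a # b # v) - \<phi> (u @ b # a # v) = \<phi> (u @ bracket a b # v)"
    and "\<And>w. w \<in> lists M \<Longrightarrow> heavy k w \<Longrightarrow> \<phi> w = 0"
  shows "\<phi> \<in> enveloping_dual M k"
  using assms by (simp add: enveloping_dual_def)

lemma enveloping_dualD:
  assumes "\<phi> \<in> enveloping_dual M k"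
  shows "slotwise_linear \<phi>"
    and "u \<in> lists M \<Longrightarrow> a \<in> M \<Longrightarrow> b \<in> M \<Longrightarrow> v \<in> lists M \<Longrightarrow>
      \<phi> (u @ a # b # v) - \<phi> (u @ b # a # v) = \<phi> (u @ bracket a b # v)"
    and "w \<in> lists M \<Longrightarrow> heavy k w \<Longrightarrow> \<phi> w = 0"
  using assms by (simp_all add: enveloping_dual_def)

lemma enveloping_dual_mono: "j \<le> k \<Longrightarrow> enveloping_dual M j \<subseteq> enveloping_dual M k"
  unfolding enveloping_dual_def using heavy_mono by blast

lemma enveloping_dual_combination:
  assumes "\<phi> \<in> enveloping_dual M k" "\<psi> \<in> enveloping_dual M k"
  shows "(\<lambda>w. r * \<phi> w + s * \<psi> w) \<in> enveloping_dual M k"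
proof (rule enveloping_dualI)
  fix u a b v
  assume *: "u \<in> lists M" "a \<in> M" "b \<in> M" "v \<in> lists M"
  show "(r * \<phi> (u @ a # b # v) + s * \<psi> (u @ a # b # v)) - (r * \<phi> (u @ b # a # v) + s * \<psi> (u @ b # a # v))
    = r * \<phi> (u @ bracket a b # v) + s * \<psi> (u @ bracket a b # v)"
    unfolding enveloping_dualD(2)[OF assms(1) *, symmetric] enveloping_dualD(2)[OF assms(2) *, symmetric]
    by (simp add: algebra_simps)
qed (use assms in \<open>auto simp: enveloping_dual_def slotwise_linear_combination\<close>)

lemma enveloping_dual_translate:
  assumes \<phi>: "\<phi> \<in> enveloping_dual M k" and m: "m \<in> M" "m \<in> lower_central_series n"
  shows "(\<lambda>v. \<phi> (m # v)) \<in> enveloping_dual M (k - Suc n)"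
proof (rule enveloping_dualI)
  show "slotwise_linear (\<lambda>v. \<phi> (m # v))"
    using \<phi> by (intro slotwise_linear_translate enveloping_dualD)
  show "\<phi> (m # u @ a # b # v) - \<phi> (m # u @ b # a # v) = \<phi> (m # u @ bracket a b # v)"
    if "u \<in> lists M" "a \<in> M" "b \<in> M" "v \<in> lists M" for u a b v
    using enveloping_dualD(2)[OF \<phi>, of "m # u" a b v] that m by simp
  show "\<phi> (m # w) = 0" if "w \<in> lists M" "heavy (k - Suc n) w" for w
    using enveloping_dualD(3)[OF \<phi>, of "m # w"] that m by auto
qed

section \<open>Derivations of the enveloping algebra\<close>

text \<open>
  The sum of the values of \<open>\<phi>\<close> on the words obtained by applying \<open>ad x\<close> to one letter. This is the
  transpose of the derivation of the tensor algebra that extends \<open>ad x\<close>.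
\<close>

primrec lie_derivative :: "'l \<Rightarrow> ('l list \<Rightarrow> 'k) \<Rightarrow> 'l list \<Rightarrow> 'k" where
  "lie_derivative x \<phi> [] = 0"
| "lie_derivative x \<phi> (m # w) = \<phi> (bracket x m # w) + lie_derivative x (\<lambda>v. \<phi> (m # v)) w"

lemma lie_derivative_combination:
  "lie_derivative x (\<lambda>v. r * \<phi> v + s * \<psi> v) w = r * lie_derivative x \<phi> w + s * lie_derivative x \<psi> w"
proof (induction w arbitrary: \<phi> \<psi>)
  case (Cons m w)
  show ?case by (simp add: Cons.IH[of "\<lambda>v. \<phi> (m # v)" "\<lambda>v. \<psi> (m # v)"] algebra_simps)
qed simp

lemma lie_derivative_cong:
  assumes "\<And>v. v \<in> lists M \<Longrightarrow> \<phi> v = \<psi> v" "w \<in> lists M" "\<And>m. m \<in> M \<Longrightarrow> bracket x m \<in> M"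
  shows "lie_derivative x \<phi> w = lie_derivative x \<psi> w"
  using assms
proof (induction w arbitrary: \<phi> \<psi>)
  case (Cons m w)
  have "lie_derivative x (\<lambda>v. \<phi> (m # v)) w = lie_derivative x (\<lambda>v. \<psi> (m # v)) w"
    using Cons.prems by (intro Cons.IH) auto
  then show ?case using Cons.prems by auto
qed simp

lemma slotwise_linear_lie_derivative:
  assumes "slotwise_linear \<phi>"
  shows "slotwise_linear (lie_derivative x \<phi>)"
proof -
  have add: "lie_derivative x \<phi> (u @ (y + z) # v)
      = lie_derivative x \<phi> (u @ y # v) + lie_derivative x \<phi> (u @ z # v)"
    if "slotwise_linear \<phi>" for \<phi> u y z v
    using that
  proof (induction u arbitrary: \<phi>)
    case Nil
    have "lie_derivative x (\<lambda>w. \<phi> ((y + z) # w)) v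
      = lie_derivative x (\<lambda>w. 1 * \<phi> (y # w) + 1 * \<phi> (z # w)) v"
      by (simp add: slotwise_linear_head[OF Nil])
    also have "\<dots> = lie_derivative x (\<lambda>w. \<phi> (y # w)) v + lie_derivative x (\<lambda>w. \<phi> (z # w)) v"
      unfolding lie_derivative_combination by simp
    finally show ?case by (simp add: bracket_linear slotwise_linear_head[OF Nil])
  next
    case (Cons m u)
    show ?case
      using Cons.IH[OF slotwise_linear_translate[OF Cons.prems]]
        slotwise_linear_add[OF Cons.prems, of "bracket x m # u"] by simp
  qed
  have scale: "lie_derivative x \<phi> (u @ scale r y # v) = r * lie_derivative x \<phi> (u @ y # v)"
    if "slotwise_linear \<phi>" for \<phi> u r y v
    using that
  proof (induction u arbitrary: \<phi>)
    case Nil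
    have "lie_derivative x (\<lambda>w. \<phi> (scale r y # w)) v
      = lie_derivative x (\<lambda>w. r * \<phi> (y # w) + 0 * \<phi> (y # w)) v"
      by (simp add: slotwise_linear_head[OF Nil])
    also have "\<dots> = r * lie_derivative x (\<lambda>w. \<phi> (y # w)) v"
      unfolding lie_derivative_combination by simp
    finally show ?case by (simp add: bracket_linear slotwise_linear_head[OF Nil] algebra_simps)
  next
    case (Cons m u)
    show ?case
      using Cons.IH[OF slotwise_linear_translate[OF Cons.prems]]
        slotwise_linear_scale[OF Cons.prems, of "bracket x m # u"] by (simp add: algebra_simps)
  qed
  show ?thesis
    unfolding slotwise_linear_def using add[OF assms] scale[OF assms] by blast
qed

text \<open>
  A derivation preserves the ideal of relations. For \<open>u = []\<close> the terms with \<open>ad x\<close> on \<open>a\<close> or \<open>b\<close>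
  combine to \<open>\<phi>([[x,a],b] v) + \<phi>([a,[x,b]] v)\<close>, which is \<open>\<phi>([x,[a,b]] v)\<close> by Jacobi.
\<close>

lemma lie_derivative_bracket_relation:
  assumes "\<phi> \<in> enveloping_dual M k" and x: "\<And>m. m \<in> M \<Longrightarrow> bracket x m \<in> M"
    and "u \<in> lists M" and ab: "a \<in> M" "b \<in> M" and v: "v \<in> lists M"
  shows "lie_derivative x \<phi> (u @ a # b # v) - lie_derivative x \<phi> (u @ b # a # v)
    = lie_derivative x \<phi> (u @ bracket a b # v)"
  using assms(1) \<open>u \<in> lists M\<close>
proof (induction u arbitrary: \<phi> k)
  case Nil
  note \<phi> = \<open>\<phi> \<in> enveloping_dual M k\<close>
  note rel = enveloping_dualD(2)[OF \<phi>, where u = "[]" and v = v, simplified]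
  have "lie_derivative x (\<lambda>w. \<phi> (a # b # w)) v - lie_derivative x (\<lambda>w. \<phi> (b # a # w)) v
    = lie_derivative x (\<lambda>w. 1 * \<phi> (a # b # w) + (- 1) * \<phi> (b # a # w)) v"
    unfolding lie_derivative_combination by simp
  also have "\<dots> = lie_derivative x (\<lambda>w. \<phi> (bracket a b # w)) v"
    using enveloping_dualD(2)[OF \<phi>, where u = "[]"] ab v x
    by (intro lie_derivative_cong[of M]) auto
  finally have tail: "lie_derivative x (\<lambda>w. \<phi> (a # b # w)) v - lie_derivative x (\<lambda>w. \<phi> (b # a # w)) v
    = lie_derivative x (\<lambda>w. \<phi> (bracket a b # w)) v" .
  have "\<phi> (bracket x (bracket a b) # v)
    = (\<phi> (bracket x a # b # v) - \<phi> (b # bracket x a # v)) + (\<phi> (a # bracket x b # v) - \<phi> (bracket x b # a # v))"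
    using rel[of "bracket x a" b] rel[of a "bracket x b"] ab v x
    by (simp add: bracket_bracket_right[of x a b] slotwise_linear_head[OF enveloping_dualD(1)[OF \<phi>]])
  then show ?case using tail by (simp add: algebra_simps)
next
  case (Cons m u)
  have m: "m \<in> M" "m \<in> lower_central_series 0" and u: "u \<in> lists M"
    using Cons.prems by auto
  show ?case
    using Cons.IH[OF enveloping_dual_translate[OF Cons.prems(1) m] u]
      enveloping_dualD(2)[OF Cons.prems(1), of "bracket x m # u" a b v] m u ab v x
    by (simp add: algebra_simps)
qed

text \<open>Applying \<open>ad x\<close> to a letter raises its weight by the weight of \<open>x\<close>.\<close>

lemma lie_derivative_heavy:
  assumes "\<phi> \<in> enveloping_dual M k" "\<And>m. m \<in> M \<Longrightarrow> bracket x m \<in> M" "x \<in> lower_central_series n"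
    and "w \<in> lists M" "heavy (k - Suc n) w"
  shows "lie_derivative x \<phi> w = 0"
  using assms
proof (induction w arbitrary: \<phi> k)
  case (Cons m w)
  obtain j where m: "m \<in> M" "m \<in> lower_central_series j" and w: "w \<in> lists M"
    and h: "heavy (k - Suc n - Suc j) w"
    using Cons.prems by auto
  have "heavy (k - Suc (Suc (n + j))) w"
    using h by (simp add: algebra_simps)
  then have "heavy k (bracket x m # w)"
    using bracket_lower_central_series[OF Cons.prems(3) m(2)] unfolding heavy.simps by blast
  then have "\<phi> (bracket x m # w) = 0"
    using enveloping_dualD(3)[OF Cons.prems(1), of "bracket x m # w"] Cons.prems(2) m w by auto
  moreover have "lie_derivative x (\<lambda>v. \<phi> (m # v)) w = 0"
    using Cons.IH[OF enveloping_dual_translate[OF Cons.prems(1) m] Cons.prems(2,3) w] h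
    by (simp add: algebra_simps)
  ultimately show ?case by simp
qed simp

lemma enveloping_dual_lie_derivative:
  assumes "\<phi> \<in> enveloping_dual M k" "\<And>m. m \<in> M \<Longrightarrow> bracket x m \<in> M" "x \<in> lower_central_series n"
  shows "lie_derivative x \<phi> \<in> enveloping_dual M (k - Suc n)"
proof (rule enveloping_dualI)
  show "slotwise_linear (lie_derivative x \<phi>)"
    by (rule slotwise_linear_lie_derivative[OF enveloping_dualD(1)[OF assms(1)]])
qed (use assms in \<open>blast intro: lie_derivative_bracket_relation lie_derivative_heavy\<close>)+

end

section \<open>Extending functionals by one dimension\<close>

text \<open>
  \<open>M\<close> lies between consecutive terms of the lower central series and \<open>x\<close> is taken from the upper
  one. The maps \<open>c\<close> and \<open>p\<close> are the coordinate of \<open>x\<close> and the projection to \<open>M\<close>. They are defined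
  on the whole algebra, which keeps the extended functionals linear on all words.
\<close>

locale codim_one_extension = lie_algebra +
  fixes M :: "'b set" and x :: 'b and a :: nat and c :: "'b \<Rightarrow> 'a" and p :: "'b \<Rightarrow> 'b"
  assumes subspace_M: "subspace M"
    and lower_M: "lower_central_series (Suc a) \<subseteq> M"
    and M_upper: "M \<subseteq> lower_central_series a"
    and x_upper: "x \<in> lower_central_series a"
    and c_add: "c (y + z) = c y + c z" and c_scale: "c (scale r y) = r * c y"
    and p_add: "p (y + z) = p y + p z" and p_scale: "p (scale r y) = scale r (p y)"
    and c_x: "c x = 1" and p_x: "p x = 0"
    and c_M: "m \<in> M \<Longrightarrow> c m = 0" and p_M: "m \<in> M \<Longrightarrow> p m = m"
    and p_in_M: "p y \<in> M"
begin

definition M' :: "'b set" where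
  "M' = span (insert x M)"

lemma M'_decompose: "y \<in> M' \<Longrightarrow> y = scale (c y) x + p y"
proof -
  assume "y \<in> M'"
  then obtain r where "y - scale r x \<in> span M"
    unfolding M'_def span_breakdown_eq by blast
  then have m: "y - scale r x \<in> M"
    by (simp add: span_eq_iff[THEN iffD2, OF subspace_M])
  obtain m where m: "m \<in> M" "y = scale r x + m"
    using m by (metis add.commute diff_add_cancel)
  then show ?thesis
    by (simp add: c_add c_scale p_add p_scale c_x p_x c_M p_M)
qed

lemma M'_upper: "M' \<subseteq> lower_central_series a"
  unfolding M'_def using M_upper x_upper
  by (intro span_minimal subspace_lower_central_series) auto

lemma bracket_in_M:
  assumes "y \<in> lower_central_series a" "z \<in> lower_central_series a"
  shows "bracket y z \<in> M"
proof -
  have "bracket y z \<in> lower_central_series (Suc (a + a))"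
    using assms by (rule bracket_lower_central_series)
  then show ?thesis
    using lower_central_series_antimono[of "Suc a" "Suc (a + a)"] lower_M by auto
qed

lemma bracket_x_in_M: "m \<in> M \<Longrightarrow> bracket x m \<in> M"
  using bracket_in_M x_upper M_upper by blast

text \<open>
  Translation \<open>\<phi> \<mapsto> (w \<mapsto> \<phi>(m w))\<close> for \<open>m\<close> in \<open>M\<close> and the derivation for \<open>x\<close>. Both reverse the order
  of products, hence the order of \<open>y\<close> and \<open>z\<close> in \<open>extended_action_bracket\<close> below.
\<close>

definition extended_action :: "'b \<Rightarrow> ('b list \<Rightarrow> 'a) \<Rightarrow> 'b list \<Rightarrow> 'a" where
  "extended_action y \<phi> w = c y * lie_derivative x \<phi> w + \<phi> (p y # w)"

lemma extended_action_combination: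
  "extended_action y (\<lambda>w. r * \<phi> w + s * \<psi> w)
    = (\<lambda>w. r * extended_action y \<phi> w + s * extended_action y \<psi> w)"
  by (simp add: extended_action_def fun_eq_iff lie_derivative_combination algebra_simps)

lemma extended_action_cong:
  assumes "\<And>v. v \<in> lists M \<Longrightarrow> \<phi> v = \<psi> v" "w \<in> lists M"
  shows "extended_action y \<phi> w = extended_action y \<psi> w"
  using lie_derivative_cong[OF assms bracket_x_in_M] assms p_in_M[of y]
  by (simp add: extended_action_def)

lemma slotwise_linear_extended_action:
  assumes "slotwise_linear \<phi>"
  shows "slotwise_linear (extended_action y \<phi>)"
  using slotwise_linear_combination[OF slotwise_linear_lie_derivative[OF assms]
      slotwise_linear_translate[OF assms], where s = 1]
  by (simp add: extended_action_def[abs_def])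

lemma extended_action_add:
  assumes "slotwise_linear \<phi>"
  shows "extended_action (y + z) \<phi> = (\<lambda>w. 1 * extended_action y \<phi> w + 1 * extended_action z \<phi> w)"
  by (simp add: extended_action_def fun_eq_iff c_add p_add slotwise_linear_head[OF assms] algebra_simps)

lemma extended_action_scale:
  assumes "slotwise_linear \<phi>"
  shows "extended_action (scale r y) \<phi> = (\<lambda>w. r * extended_action y \<phi> w + 0 * extended_action y \<phi> w)"
  by (simp add: extended_action_def fun_eq_iff c_scale p_scale slotwise_linear_head[OF assms] algebra_simps)

text \<open>
  If \<open>n \<le> a\<close>, both parts of \<open>y\<close> lie in \<open>F\<^sub>a\<close> and lower the weight by \<open>a + 1\<close>, hence by at least
  \<open>n + 1\<close>. If \<open>n > a\<close>, then \<open>y\<close> lies in \<open>F\<^sub>a\<^sub>+\<^sub>1 \<subseteq> M\<close> and acts by translation. This is why \<open>M\<close> is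
  required to be adapted to the lower central series.
\<close>

lemma enveloping_dual_extended_action:
  assumes \<phi>: "\<phi> \<in> enveloping_dual M k" and y: "y \<in> M'" "y \<in> lower_central_series n"
  shows "extended_action y \<phi> \<in> enveloping_dual M (k - Suc n)"
proof (cases "n \<le> a")
  case True
  have "k - Suc a \<le> k - Suc n" using True by simp
  note mono = subsetD[OF enveloping_dual_mono[OF this]]
  have "lie_derivative x \<phi> \<in> enveloping_dual M (k - Suc n)"
    by (rule mono[OF enveloping_dual_lie_derivative[OF \<phi> bracket_x_in_M x_upper]])
  moreover have "(\<lambda>w. \<phi> (p y # w)) \<in> enveloping_dual M (k - Suc n)"
    using p_in_M[of y] M_upper by (intro mono enveloping_dual_translate[OF \<phi>]) auto
  ultimately show ?thesis
    using enveloping_dual_combination[where s = 1] by (fastforce simp: extended_action_def[abs_def])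
next
  case False
  then have "y \<in> M"
    using y(2) lower_central_series_antimono[of "Suc a" n] lower_M by auto
  then show ?thesis
    using enveloping_dual_translate[OF \<phi> _ y(2)] by (simp add: extended_action_def[abs_def] c_M p_M)
qed

text \<open>
  Two translations satisfy the identity by the relation for \<open>\<phi>\<close>. For \<open>x\<close> and a translation by \<open>m\<close>,
  the commutator keeps exactly the term of the derivation in which \<open>ad x\<close> hits the letter \<open>m\<close>.
\<close>

lemma extended_action_bracket:
  assumes \<phi>: "\<phi> \<in> enveloping_dual M k" and yz: "y \<in> M'" "z \<in> M'" and w: "w \<in> lists M"
  shows "extended_action z (extended_action y \<phi>) w - extended_action y (extended_action z \<phi>) w
    = extended_action (bracket y z) \<phi> w"
proof -
  let ?D = "lie_derivative x"
  have comm: "extended_action z (extended_action y \<phi>) w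
    = c z * c y * ?D (?D \<phi>) w + c z * ?D (\<lambda>v. \<phi> (p y # v)) w
      + c y * \<phi> (bracket x (p z) # w) + c y * ?D (\<lambda>v. \<phi> (p z # v)) w + \<phi> (p y # p z # w)" for y z
    using lie_derivative_combination[where s = 1 and x = x and w = w and r = "c y" and \<phi> = "?D \<phi>"]
    by (simp add: extended_action_def[abs_def] algebra_simps)
  have in_M: "bracket y z \<in> M"
    using bracket_in_M yz M'_upper by blast
  have "bracket y z = bracket (scale (c y) x + p y) (scale (c z) x + p z)"
    using M'_decompose[OF yz(1)] M'_decompose[OF yz(2)] by simp
  also have "\<dots> = scale (c y) (bracket x (p z)) + scale (- c z) (bracket x (p y)) + bracket (p y) (p z)"
    by (simp add: bracket_linear bracket_self bracket_skew[of _ x] algebra_simps)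
  finally have bracket_yz: "bracket y z = \<dots>" .
  have "\<phi> (bracket y z # w) = c y * \<phi> (bracket x (p z) # w) - c z * \<phi> (bracket x (p y) # w)
      + (\<phi> (p y # p z # w) - \<phi> (p z # p y # w))"
    using enveloping_dualD(2)[OF \<phi>, where u = "[]" and v = w] p_in_M w
    unfolding bracket_yz by (simp only: slotwise_linear_head[OF enveloping_dualD(1)[OF \<phi>]]) simp
  then show ?thesis
    unfolding comm by (simp add: extended_action_def c_M[OF in_M] p_M[OF in_M] algebra_simps)
qed

text \<open>The matrix coefficient of \<open>\<phi>\<close> and the evaluation at the empty word.\<close>

definition extension :: "('b list \<Rightarrow> 'a) \<Rightarrow> 'b list \<Rightarrow> 'a" where
  "extension \<phi> w = fold extended_action w \<phi> []"

lemma extension_Nil: "extension \<phi> [] = \<phi> []"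
  and extension_Cons: "extension \<phi> (y # w) = extension (extended_action y \<phi>) w"
  by (simp_all add: extension_def)

lemma extension_combination:
  "extension (\<lambda>v. r * \<phi> v + s * \<psi> v) w = r * extension \<phi> w + s * extension \<psi> w"
  by (induction w arbitrary: \<phi> \<psi>) (simp_all add: extension_Nil extension_Cons extended_action_combination)

text \<open>
  The commutation relation for the action holds only on words in \<open>M\<close>. That suffices, as all letters
  enter the computation of the extension through \<open>p\<close> or through a bracket of \<open>x\<close> with such a letter.
\<close>

lemma extension_cong:
  assumes "\<And>v. v \<in> lists M \<Longrightarrow> \<phi> v = \<psi> v"
  shows "extension \<phi> w = extension \<psi> w"
  using assms
proof (induction w arbitrary: \<phi> \<psi>)
  case (Cons y w)
  show ?case
    unfolding extension_Cons by (intro Cons.IH extended_action_cong Cons.prems)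
qed (simp add: extension_Nil)

lemma enveloping_dual_extension:
  assumes \<phi>: "\<phi> \<in> enveloping_dual M k"
  shows "extension \<phi> \<in> enveloping_dual M' k"
proof (rule enveloping_dualI)
  have "extension \<phi> (u @ (y + z) # v) = extension \<phi> (u @ y # v) + extension \<phi> (u @ z # v)"
    if "slotwise_linear \<phi>" for \<phi> u y z v
    using that
    by (induction u arbitrary: \<phi>)
      (simp_all only: append.simps extension_Cons extended_action_add extension_combination
        slotwise_linear_extended_action, simp_all)
  moreover have "extension \<phi> (u @ scale r y # v) = r * extension \<phi> (u @ y # v)"
    if "slotwise_linear \<phi>" for \<phi> u r y v
    using that
    by (induction u arbitrary: \<phi>)
      (simp_all only: append.simps extension_Cons extended_action_scale extension_combination
        slotwise_linear_extended_action, simp_all)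
  ultimately show "slotwise_linear (extension \<phi>)"
    unfolding slotwise_linear_def[of "extension \<phi>"] using enveloping_dualD(1)[OF \<phi>] by blast
next
  fix u y z v
  assume u: "u \<in> lists M'" and yz: "y \<in> M'" "z \<in> M'" and "v \<in> lists M'"
  show "extension \<phi> (u @ y # z # v) - extension \<phi> (u @ z # y # v) = extension \<phi> (u @ bracket y z # v)"
    using \<phi> u
  proof (induction u arbitrary: \<phi> k)
    case Nil
    have "extension (extended_action z (extended_action y \<phi>)) v
        - extension (extended_action y (extended_action z \<phi>)) v
      = extension (\<lambda>w. 1 * extended_action z (extended_action y \<phi>) w
        + (- 1) * extended_action y (extended_action z \<phi>) w) v"
      unfolding extension_combination by simp
    also have "\<dots> = extension (extended_action (bracket y z) \<phi>) v"
      using extended_action_bracket[OF Nil(1) yz] by (intro extension_cong) simp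
    finally show ?case by (simp add: extension_Cons)
  next
    case (Cons t u)
    have t: "t \<in> M'" "t \<in> lower_central_series 0" and u: "u \<in> lists M'"
      using Cons.prems by auto
    show ?case
      using Cons.IH[OF enveloping_dual_extended_action[OF Cons.prems(1) t] u]
      by (simp add: extension_Cons)
  qed
next
  fix w
  assume "w \<in> lists M'" "heavy k w"
  then show "extension \<phi> w = 0"
    using \<phi>
  proof (induction w arbitrary: \<phi> k rule: list.induct)
    case Nil
    then show ?case
      using enveloping_dualD(3)[of \<phi> M k "[]"] by (simp add: extension_Nil)
  next
    case (Cons y w)
    obtain n where "y \<in> M'" "y \<in> lower_central_series n" "w \<in> lists M'" "heavy (k - Suc n) w"
      using Cons.prems by auto
    then show ?case
      using Cons.IH[OF _ _ enveloping_dual_extended_action[OF Cons.prems(3)]]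
      by (simp add: extension_Cons)
  qed
qed

lemma extension_singleton: "m \<in> M \<Longrightarrow> extension \<phi> [m] = \<phi> [m]"
  by (simp add: extension_Cons extension_Nil extended_action_def p_M)

text \<open>
  On words of length one the relation asks that \<open>c\<close> vanish on brackets, and these lie in \<open>M\<close>. A single
  letter of weight \<open>n + 1\<close> or more lies in \<open>F\<^sub>n = 0\<close>; this determines the bound \<open>Suc n\<close>.
\<close>

lemma coordinate_in_enveloping_dual:
  assumes "lower_central_series n = {0}"
  shows "(\<lambda>w. if length w = 1 then c (hd w) else 0) \<in> enveloping_dual M' (Suc n)" (is "?\<phi> \<in> _")
proof (rule enveloping_dualI)
  have "?\<phi> (u @ (y + z) # v) = ?\<phi> (u @ y # v) + ?\<phi> (u @ z # v)"
    "?\<phi> (u @ scale r y # v) = r * ?\<phi> (u @ y # v)" for u y z v r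
    by (cases u; simp add: c_add c_scale)+
  then show "slotwise_linear ?\<phi>"
    unfolding slotwise_linear_def by blast
  show "?\<phi> (u @ y # z # v) - ?\<phi> (u @ z # y # v) = ?\<phi> (u @ bracket y z # v)"
    if "y \<in> M'" "z \<in> M'" for u y z v
  proof -
    have "c (bracket y z) = 0"
      using bracket_in_M that M'_upper c_M by blast
    then show ?thesis by (cases u) simp_all
  qed
  show "?\<phi> w = 0" if heavy: "heavy (Suc n) w" for w
  proof (cases "length w = 1")
    case True
    then obtain y where "w = [y]"
      by (auto simp: length_Suc_conv)
    then obtain j where y: "w = [y]" "y \<in> lower_central_series j" "n \<le> j"
      using heavy by auto
    then have "y = 0"
      using lower_central_series_antimono[of n j] assms by blast
    then show ?thesis
      using y c_M[of 0] subspace_0[OF subspace_M] by simp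
  qed simp
qed

end

section \<open>Functionals detect all elements\<close>

context lie_algebra
begin

text \<open>The natural map from \<open>M\<close> to its truncated enveloping algebra is injective.\<close>

definition separated :: "'l set \<Rightarrow> nat \<Rightarrow> bool" where
  "separated M k \<longleftrightarrow> (\<forall>m\<in>M. m \<noteq> 0 \<longrightarrow> (\<exists>\<phi>\<in>enveloping_dual M k. \<phi> [m] \<noteq> 0))"

lemma coordinate_and_projection:
  assumes M: "subspace M" and x: "x \<notin> M"
  obtains c p where
    "\<And>y z. c (y + z) = c y + c z" "\<And>r y. c (scale r y) = r * c y"
    "\<And>y z. p (y + z) = p y + p z" "\<And>r y. p (scale r y) = scale r (p y)"
    "c x = 1" "p x = 0" "\<And>m. m \<in> M \<Longrightarrow> c m = 0" "\<And>m. m \<in> M \<Longrightarrow> p m = m" "\<And>y. p y \<in> M"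
proof -
  interpret field: vector_space "(*) :: 'k \<Rightarrow> 'k \<Rightarrow> 'k"
    by unfold_locales (auto simp: algebra_simps)
  interpret coordinate: vector_space_pair scale "(*) :: 'k \<Rightarrow> 'k \<Rightarrow> 'k" ..
  interpret endo: vector_space_pair scale scale ..
  obtain B where B: "B \<subseteq> M" "independent B" "M \<subseteq> span B"
    by (rule maximal_independent_subset)
  have spanB: "span B = M"
    using B M by (metis span_minimal subset_antisym)
  let ?B = "insert x B"
  have ind: "independent ?B"
    using B x spanB by (intro independent_insertI) auto
  define c where "c = coordinate.construct ?B (\<lambda>b. if b = x then 1 else 0)"
  define p where "p = endo.construct ?B (\<lambda>b. if b = x then 0 else b)"
  interpret c: Vector_Spaces.linear scale "(*)" c
    unfolding c_def by (rule coordinate.linear_construct[OF ind])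
  interpret p: Vector_Spaces.linear scale scale p
    unfolding p_def by (rule endo.linear_construct[OF ind])
  have xB: "b \<noteq> x" if "b \<in> B" for b
    using that B x by blast
  have cB: "c b = 0" and pB: "p b = b" if "b \<in> B" for b
    using that xB unfolding c_def p_def
    by (simp_all add: coordinate.construct_basis[OF ind] endo.construct_basis[OF ind])
  have c_M: "c m = 0" if "m \<in> M" for m
    using c.eq_0_on_span[of B m] cB that spanB by blast
  have p_M: "p m = m" if "m \<in> M" for m
    using endo.linear_eq_on[OF p.linear_axioms linear_ident, of m B] pB that spanB by auto
  have "p y \<in> span ((\<lambda>b. if b = x then 0 else b) ` ?B)" for y
    unfolding p_def by (rule endo.construct_in_span[OF ind])
  also have "span ((\<lambda>b. if b = x then 0 else b) ` ?B) \<subseteq> M"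
    using B M by (intro span_minimal) (auto simp: subspace_0)
  finally have p_in_M: "p y \<in> M" for y .
  have "c x = 1" "p x = 0"
    unfolding c_def p_def
    by (simp_all add: coordinate.construct_basis[OF ind] endo.construct_basis[OF ind])
  from that[OF c.add c.scale p.add p.scale this c_M p_M p_in_M] show thesis .
qed

text \<open>
  Elements with a nonzero \<open>x\<close>-coordinate are detected by that coordinate; the others lie in \<open>M\<close> and
  are detected by the extension of a functional that exists by hypothesis.
\<close>

lemma separated_insert:
  assumes M: "subspace M" "lower_central_series (Suc a) \<subseteq> M" "M \<subseteq> lower_central_series a"
    and x: "x \<in> lower_central_series a" and n: "lower_central_series n = {0}"
    and sep: "separated M (Suc n)"
  shows "separated (span (insert x M)) (Suc n)"
proof (cases "x \<in> M")
  case True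
  then have "span (insert x M) = M"
    using M(1) by (simp add: insert_absorb span_eq_iff)
  then show ?thesis using sep by simp
next
  case False
  obtain c p where cp:
    "\<And>y z. c (y + z) = c y + c z" "\<And>r y. c (scale r y) = r * c y"
    "\<And>y z. p (y + z) = p y + p z" "\<And>r y. p (scale r y) = scale r (p y)"
    "c x = 1" "p x = 0" "\<And>m. m \<in> M \<Longrightarrow> c m = 0" "\<And>m. m \<in> M \<Longrightarrow> p m = m" "\<And>y. p y \<in> M"
    by (rule coordinate_and_projection[OF M(1) False]) (rule that)
  interpret codim_one_extension scale bracket M x a c p
    by unfold_locales (fact M x cp | rule cp, assumption)+
  have "\<exists>\<phi>\<in>enveloping_dual M' (Suc n). \<phi> [y] \<noteq> 0" if y: "y \<in> M'" "y \<noteq> 0" for y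
  proof (cases "c y = 0")
    case True
    then have "p y = y"
      using M'_decompose[OF y(1)] by simp
    then have "y \<in> M"
      using p_in_M[of y] by simp
    then show ?thesis
      using sep y(2) enveloping_dual_extension extension_singleton
      unfolding separated_def by metis
  next
    case False
    then show ?thesis
      by (intro bexI[OF _ coordinate_in_enveloping_dual[OF n]]) simp
  qed
  then show ?thesis
    unfolding separated_def M'_def by blast
qed

text \<open>
  Induction upwards from \<open>F\<^sub>n = 0\<close>: a basis of \<open>F\<^sub>a\<close> is added to \<open>F\<^sub>a\<^sub>+\<^sub>1\<close> one vector at a time.
\<close>

lemma separated_UNIV:
  assumes fin: "finite Basis" "span Basis = UNIV" and n: "lower_central_series n = {0}"
  shows "separated UNIV (Suc n)"
proof -
  have "separated (lower_central_series (n - j)) (Suc n)" if "j \<le> n" for j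
    using that
  proof (induction j)
    case 0
    then show ?case by (simp add: n separated_def)
  next
    case (Suc j)
    define a where "a = n - Suc j"
    have a: "n - j = Suc a" using Suc.prems by (simp add: a_def)
    let ?U = "lower_central_series (Suc a)" and ?V = "lower_central_series a"
    obtain S where S: "S \<subseteq> ?V" "independent S" "?V \<subseteq> span S"
      by (rule maximal_independent_subset)
    have "finite S"
      using independent_span_bound[OF fin(1) S(2)] fin(2) by simp
    then have "separated (span (S \<union> ?U)) (Suc n)"
      using S(1)
    proof (induction S rule: finite_induct)
      case empty
      show ?case
        using Suc a subspace_lower_central_series[of "Suc a"]
        by (simp del: lower_central_series.simps add: span_eq_iff[THEN iffD2])
    next
      case (insert x S)
      have "span (insert x (span (S \<union> ?U))) = span (insert x S \<union> ?U)"
        by (rule span_eq[THEN iffD2])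
          (auto intro: span_base span_mono[THEN subsetD])
      moreover have "separated (span (insert x (span (S \<union> ?U)))) (Suc n)"
      proof (rule separated_insert[where a = a])
        show "?U \<subseteq> span (S \<union> ?U)" 
          by (meson Un_upper2 order_trans span_superset)
        show "span (S \<union> ?U) \<subseteq> ?V"
          using insert.prems lower_central_series_Suc_subset[of a]
          by (intro span_minimal subspace_lower_central_series) blast
      qed (use insert n in auto)
      ultimately show ?case by simp
    qed
    moreover have "span (S \<union> ?U) = ?V"
    proof (rule subset_antisym)
      show "span (S \<union> ?U) \<subseteq> ?V"
        using S(1) lower_central_series_Suc_subset[of a]
        by (intro span_minimal subspace_lower_central_series) blast
      show "?V \<subseteq> span (S \<union> ?U)"
        using S(3) span_mono[of S "S \<union> ?U"] by blast
    qed
    ultimately show ?case by (simp add: a_def)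
  qed
  from this[of n] show ?thesis by simp
qed

section \<open>The representation\<close>

text \<open>
  The letters of \<open>w\<close> are freed one by one, by linearity in the first letter that is not yet required
  to be in the basis.
\<close>

lemma eq_zero_if_zero_on_basis_words:
  assumes "slotwise_linear \<phi>" "span Basis = UNIV"
    and zero: "\<And>w. w \<in> lists Basis \<Longrightarrow> \<phi> w = 0"
  shows "\<phi> w = 0"
proof -
  interpret field: vector_space "(*) :: 'k \<Rightarrow> 'k \<Rightarrow> 'k"
    by unfold_locales (auto simp: algebra_simps)
  have "\<phi> (u @ w) = 0" if "u \<in> lists Basis" for u
    using that
  proof (induction w arbitrary: u)
    case Nil
    then show ?case using zero by simp
  next
    case (Cons y w)
    interpret f: Vector_Spaces.linear scale "(*)" "\<lambda>y. \<phi> (u @ y # w)"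
      using slotwise_linear_add[OF assms(1)] slotwise_linear_scale[OF assms(1)]
      by (simp add: Vector_Spaces.linear_iff vector_space_axioms field.vector_space_axioms)
    have "\<phi> (u @ b # w) = 0" if "b \<in> Basis" for b
      using Cons.IH[of "u @ [b]"] Cons.prems that by simp
    then show ?case
      using f.eq_0_on_span[of Basis y] assms(2) by simp
  qed
  from this[of "[]"] show ?thesis by simp
qed

text \<open>The sign turns the order-reversing translation into a homomorphism of Lie algebras.\<close>

definition left_action :: "'l \<Rightarrow> ('l list \<Rightarrow> 'k) \<Rightarrow> 'l list \<Rightarrow> 'k" where
  "left_action x \<phi> w = - \<phi> (x # w)"

lemma enveloping_dual_left_action:
  assumes "\<phi> \<in> enveloping_dual M k" "x \<in> M"
  shows "left_action x \<phi> \<in> enveloping_dual M (k - 1)"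
proof -
  have "(\<lambda>v. \<phi> (x # v)) \<in> enveloping_dual M (k - 1)"
    using enveloping_dual_translate[OF assms, of 0] by simp
  from enveloping_dual_combination[OF this this, of "- 1" 0] show ?thesis
    by (simp add: left_action_def[abs_def])
qed

lemma left_action_bracket:
  assumes "\<phi> \<in> enveloping_dual M k" "x \<in> M" "y \<in> M" "w \<in> lists M"
  shows "left_action (bracket x y) \<phi> w
    = left_action x (left_action y \<phi>) w - left_action y (left_action x \<phi>) w"
  using enveloping_dualD(2)[OF assms(1), of "[]" x y w, symmetric] assms(2-) by (simp add: left_action_def)

text \<open>
  Every element has weight at least one, so \<open>k\<close> applications lead to a functional that vanishes on
  all words of weight at least zero, the empty word included.
\<close>

lemma left_action_nilpotent:
  assumes "\<phi> \<in> enveloping_dual UNIV k"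
  shows "(left_action x ^^ k) \<phi> w = 0"
proof -
  have "(left_action x ^^ j) \<phi> \<in> enveloping_dual UNIV (k - j)" for j
  proof (induction j)
    case (Suc j)
    from enveloping_dual_left_action[OF this, of x] show ?case by simp
  qed (use assms in simp)
  from enveloping_dualD(3)[OF this[of k], of w] show ?thesis
    by (simp add: heavy_length)
qed

end

lemma (in vector_space) finite_dimensional_subspace:
  assumes "subspace V" "finite E" "V \<subseteq> span E"
  shows "\<exists>B. finite B \<and> span B = V"
proof -
  obtain B where B: "B \<subseteq> V" "independent B" "V \<subseteq> span B"
    by (rule maximal_independent_subset)
  have "finite B"
    using independent_span_bound[OF assms(2) B(2)] B(1) assms(3) by auto
  moreover have "span B = V"
    using B assms(1) span_minimal[of B V] by blast
  ultimately show ?thesis by blast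
qed

interpretation seq: vector_space seq_scale
  by (rule vector_space_seq_scale)

lemma finitely_supported_in_span:
  "(\<And>j. N \<le> j \<Longrightarrow> f j = 0) \<Longrightarrow> f \<in> seq.span ((\<lambda>i j. of_bool (i = j)) ` {..<N})"
proof (induction N arbitrary: f)
  case 0
  then have "f = 0" by (simp add: fun_eq_iff)
  then show ?case by (simp only: seq.span_zero)
next
  case (Suc N)
  have "f - seq_scale (f N) (\<lambda>j. of_bool (N = j)) \<in> seq.span ((\<lambda>i j. of_bool (i = j)) ` {..<N})"
    using Suc.prems by (intro Suc.IH) (auto simp: seq_scale_def Suc_le_eq order_le_less[of N])
  then show ?case
    unfolding lessThan_Suc image_insert seq.span_breakdown_eq by blast
qed

theorem theorem2p11:
  fixes scale :: "'k::field_char_0 \<Rightarrow> 'l::ab_group_add \<Rightarrow> 'l"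
    and bracket :: "'l \<Rightarrow> 'l \<Rightarrow> 'l"
    and Basis :: "'l set"
  assumes "finite_dimensional_vector_space scale Basis"
    and "nilpotent_lie_algebra scale bracket"
  shows "\<exists>(V :: (nat \<Rightarrow> 'k) set) \<rho>.
    faithful_representation scale bracket seq_scale V \<rho> \<and>
    nilpotent_representation scale bracket seq_scale V \<rho>"
proof -
  interpret fd: finite_dimensional_vector_space scale Basis by fact
  interpret nilpotent_lie_algebra scale bracket by fact
  obtain n where n: "lower_central_series n = {0}"
    using lower_central_series_terminates by blast
  define k where "k = Suc n"
  define W where "W = enveloping_dual UNIV k"
  have W_combination: "(\<lambda>w. r * \<phi> w + s * \<psi> w) \<in> W" if "\<phi> \<in> W" "\<psi> \<in> W" for r s \<phi> \<psi>
    using that unfolding W_def by (rule enveloping_dual_combination)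
  have W_zero: "(\<lambda>w. 0) \<in> W"
    unfolding W_def by (rule enveloping_dualI) (simp_all add: slotwise_linear_def)
  have W_action: "left_action x \<phi> \<in> W" if "\<phi> \<in> W" for x \<phi>
    using enveloping_dual_left_action[of \<phi> UNIV k x] enveloping_dual_mono[of "k - 1" k UNIV] that
    by (auto simp: W_def)
  have W_linear: "slotwise_linear \<phi>" if "\<phi> \<in> W" for \<phi>
    using that unfolding W_def by (rule enveloping_dualD)

  \<comment> \<open>Embed \<open>W\<close> into sequences by listing the values on the finitely many basis words of length at most
     \<open>k\<close>; longer words are heavy, so this loses nothing.\<close>
  define A where "A = {w. set w \<subseteq> Basis \<and> length w \<le> k}"
  have "finite A"
    unfolding A_def by (rule finite_lists_length_le[OF fd.finite_Basis])
  then obtain h where h: "bij_betw h {0..<card A} A"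
    using ex_bij_betw_nat_finite by blast
  define \<theta> where "\<theta> \<phi> i = (if i < card A then \<phi> (h i) else 0)" for \<phi> :: "'l list \<Rightarrow> 'k" and i
  have \<theta>_add: "\<theta> \<phi> + \<theta> \<psi> = \<theta> (\<lambda>w. \<phi> w + \<psi> w)"
    and \<theta>_diff: "\<theta> \<phi> - \<theta> \<psi> = \<theta> (\<lambda>w. \<phi> w - \<psi> w)"
    and \<theta>_scale: "seq_scale r (\<theta> \<phi>) = \<theta> (\<lambda>w. r * \<phi> w)"
    and \<theta>_zero: "\<theta> (\<lambda>w. 0) = 0" for r \<phi> \<psi>
    by (simp_all add: \<theta>_def fun_eq_iff seq_scale_def)
  have W_add: "(\<lambda>w. \<phi> w + \<psi> w) \<in> W" and W_scale: "(\<lambda>w. r * \<phi> w) \<in> W"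
    if "\<phi> \<in> W" "\<psi> \<in> W" for r \<phi> \<psi>
    using W_combination[OF that, of 1 1] W_combination[OF that, of r 0] by simp_all
  have "inj_on \<theta> W"
  proof (rule inj_onI)
    fix \<phi> \<psi> assume \<phi>: "\<phi> \<in> W" and \<psi>: "\<psi> \<in> W" and eq: "\<theta> \<phi> = \<theta> \<psi>"
    let ?d = "\<lambda>w. 1 * \<phi> w + (- 1) * \<psi> w"
    have d: "?d \<in> W" by (rule W_combination[OF \<phi> \<psi>])
    have "?d w = 0" if "w \<in> lists Basis" for w
    proof (cases "w \<in> A")
      case True
      then have "w \<in> h ` {0..<card A}"
        using h by (simp add: bij_betw_def)
      then obtain i where "i < card A" "w = h i"
        by auto
      then show ?thesis
        using fun_cong[OF eq, of i] by (simp add: \<theta>_def)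
    next
      case False
      then have "heavy k w"
        using that by (intro heavy_length) (auto simp: A_def)
      then show ?thesis
        using enveloping_dualD(3)[of ?d UNIV k w] d by (simp add: W_def)
    qed
    then have "?d w = 0" for w
      by (rule eq_zero_if_zero_on_basis_words[OF W_linear[OF d] fd.span_Basis])
    then show "\<phi> = \<psi>" by (simp add: fun_eq_iff)
  qed
  define V where "V = \<theta> ` W"
  define \<rho> where "\<rho> x = (\<lambda>v\<in>V. \<theta> (left_action x (inv_into W \<theta> v)))" for x
  have \<theta>_V: "\<theta> \<phi> \<in> V" if "\<phi> \<in> W" for \<phi>
    using that by (simp add: V_def)
  have V_cases: "\<exists>\<phi>\<in>W. v = \<theta> \<phi>" if "v \<in> V" for v
    using that by (auto simp: V_def)
  have \<rho>_\<theta>: "\<rho> x (\<theta> \<phi>) = \<theta> (left_action x \<phi>)" if "\<phi> \<in> W" for x \<phi>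
    using that \<open>inj_on \<theta> W\<close> by (simp add: \<rho>_def V_def)
  have \<rho>_extensional: "\<rho> x \<in> extensional V" for x
    by (simp add: \<rho>_def)
  have \<rho>_eqI: "\<rho> x = (\<lambda>v\<in>V. g v)" if "\<And>\<phi>. \<phi> \<in> W \<Longrightarrow> \<theta> (left_action x \<phi>) = g (\<theta> \<phi>)" for x g
    by (rule extensionalityI[OF \<rho>_extensional restrict_extensional])
      (use that \<rho>_\<theta> V_cases in fastforce)
  have subspace_V: "seq.subspace V"
    unfolding seq.subspace_def
    using \<theta>_V[OF W_zero] W_add W_scale
    by (auto simp: V_def \<theta>_zero \<theta>_add \<theta>_scale)
  have "\<theta> \<phi> \<in> seq.span ((\<lambda>i j. of_bool (i = j)) ` {..<card A})" for \<phi>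
    by (rule finitely_supported_in_span) (simp add: \<theta>_def)
  then have finite_dim: "\<exists>B. finite B \<and> seq.span B = V"
    by (intro seq.finite_dimensional_subspace[OF subspace_V, of "(\<lambda>i j. of_bool (i = j)) ` {..<card A}"])
      (auto simp: V_def)
  interpret lie_representation scale bracket seq_scale V \<rho>
  proof unfold_locales
    show "seq.subspace V" by (rule subspace_V)
    show "\<exists>B. finite B \<and> seq.span B = V" by (rule finite_dim)
    fix x y c
    show "\<rho> x \<in> End seq_scale V"
      unfolding End_def
    proof (intro CollectI conjI ballI allI PiE_I)
      show "\<rho> x v \<in> V" if "v \<in> V" for v
        using V_cases[OF that] by (auto simp: \<rho>_\<theta> \<theta>_V W_action)
      show "\<rho> x v = undefined" if "v \<notin> V" for v
        using that by (simp add: \<rho>_def)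
      show "\<rho> x (u + v) = \<rho> x u + \<rho> x v" if "u \<in> V" "v \<in> V" for u v
        using V_cases[OF that(1)] V_cases[OF that(2)]
        by (auto simp: \<rho>_\<theta> \<theta>_add W_add left_action_def[abs_def])
      show "\<rho> x (seq_scale r v) = seq_scale r (\<rho> x v)" if "v \<in> V" for r v
        using V_cases[OF that] by (auto simp: \<rho>_\<theta> \<theta>_scale W_scale left_action_def[abs_def])
    qed
    show "\<rho> (x + y) = (\<lambda>v\<in>V. \<rho> x v + \<rho> y v)"
      by (rule \<rho>_eqI)
        (simp add: \<rho>_\<theta> \<theta>_add left_action_def[abs_def] slotwise_linear_head[OF W_linear])
    show "\<rho> (scale c x) = (\<lambda>v\<in>V. seq_scale c (\<rho> x v))"
      by (rule \<rho>_eqI)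
        (simp add: \<rho>_\<theta> \<theta>_scale left_action_def[abs_def] slotwise_linear_head[OF W_linear])
    show "\<rho> (bracket x y) = commutator V (\<rho> x) (\<rho> y)"
      unfolding commutator_def
    proof (rule \<rho>_eqI)
      fix \<phi> assume \<phi>: "\<phi> \<in> W"
      have "left_action (bracket x y) \<phi>
        = (\<lambda>w. left_action x (left_action y \<phi>) w - left_action y (left_action x \<phi>) w)"
        using left_action_bracket[of \<phi> UNIV k x y] \<phi> by (auto simp: W_def)
      then show "\<theta> (left_action (bracket x y) \<phi>) = \<rho> x (\<rho> y (\<theta> \<phi>)) - \<rho> y (\<rho> x (\<theta> \<phi>))"
        by (simp add: \<rho>_\<theta> W_action \<phi> \<theta>_diff)
    qed
  qed
  have "faithful_representation scale bracket seq_scale V \<rho>"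
  proof unfold_locales
    have "x = 0" if x: "\<rho> x = (\<lambda>v\<in>V. 0)" for x
    proof (rule ccontr)
      assume "x \<noteq> 0"
      then obtain \<phi> where \<phi>: "\<phi> \<in> W" "\<phi> [x] \<noteq> 0"
        using separated_UNIV[OF fd.finite_Basis fd.span_Basis n]
        by (auto simp: separated_def W_def k_def)
      have "\<theta> (left_action x \<phi>) = \<theta> (\<lambda>w. 0)"
        using fun_cong[OF x, of "\<theta> \<phi>"] \<phi>(1) by (simp add: \<rho>_\<theta> \<theta>_V \<theta>_zero)
      then have "left_action x \<phi> = (\<lambda>w. 0)"
        using inj_onD[OF \<open>inj_on \<theta> W\<close>] W_action[OF \<phi>(1)] W_zero by blast
      from fun_cong[OF this, of "[]"] show False
        using \<phi>(2) by (simp add: left_action_def)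
    qed
    moreover have "\<rho> 0 = (\<lambda>v\<in>V. 0)"
      using rep_scale[of 0 0] by simp
    ultimately show "{x. \<rho> x = (\<lambda>v\<in>V. 0)} = {0}" by auto
  qed
  moreover have "nilpotent_representation scale bracket seq_scale V \<rho>"
  proof unfold_locales
    fix x
    have "(\<rho> x ^^ k) v = 0" if v: "v \<in> V" for v
    proof -
      obtain \<phi> where \<phi>: "\<phi> \<in> W" "v = \<theta> \<phi>"
        using V_cases[OF v] by blast
      have "(left_action x ^^ j) \<phi> \<in> W \<and> (\<rho> x ^^ j) v = \<theta> ((left_action x ^^ j) \<phi>)" for j
        by (induction j) (simp_all add: \<phi> \<rho>_\<theta> W_action)
      moreover have "(left_action x ^^ k) \<phi> = (\<lambda>w. 0)"
        using left_action_nilpotent[of \<phi> k x] \<phi>(1) by (auto simp: W_def)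
      ultimately show ?thesis
        by (metis \<theta>_zero)
    qed
    then show "\<exists>n. \<forall>v\<in>V. (\<rho> x ^^ n) v = 0" by blast
  qed
  ultimately show ?thesis by blast
qed

end
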